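(* Assume the standing setting with $\Omega$ of type (1). Then $z=\mathfrak S_a(x)$ is a bijective conformal (biholomorphic) map from $\Omega$ onto the upper half-plane $\mathbb C_+=\{z\in\mathbb C:\operatorname{Im}z>0\}$.
   Context: Let $Q$ be a complex polynomial of degree $m\ge 1$. A turning point is a zero of $Q$. For a turning point $a$, $\mathfrak S_a(x)=\int_a^x\sqrt{Q(\tau)}\,d\tau$. The Stokes curves emanating from a turning point $a$ are the arcs of $\{x:\operatorname{Im}\mathfrak S_a(x)=0\}$ starting at $a$; each ends at $\infty$ or at another turning point (a Stokes curve ending at a turning point $b$ is joined with the Stokes curves emanating from $b$). The Stokes curves divide $\mathbb C$ into regions called Stokes domains. Standing setting: $\Omega$ is a Stokes domain, $a\in\partial\Omega$ is a turning point, a holomorphic branch of $\sqrt Q$ on $\Omega$ is fixed so that $\mathfrak S_a$ is holomorphic on $\Omega$ with $\mathfrak S_a'=\sqrt Q$, and $\operatorname{Im}\mathfrak S_a(x)>0$ for all $x\in\Omega$. Moreover $\Omega$ is of one of two types: type (1): $\partial\Omega$ is a single connected curve containing $a$, and $\operatorname{Im}\mathfrak S_a=0$ on $\partial\Omega$; type (2): $\partial\Omega=\mathcal C_1\cup\mathcal C_2$ with $\mathcal C_1\cap\mathcal C_2=\emptyset$, there are turning points $a\in\mathcal C_1$, $b\in\mathcal C_2$, $\operatorname{Im}\mathfrak S_a=0$ on $\mathcal C_1$ and $\operatorname{Im}\mathfrak S_a=\operatorname{Im}\mathfrak S_a(b)$ on $\mathcal C_2$. *)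

theory Defs
  imports "HOL-Complex_Analysis.Complex_Analysis" "HOL-Computational_Algebra.Polynomial"
begin

definition turning_point :: "complex poly \<Rightarrow> complex \<Rightarrow> bool" where
  "turning_point Q a \<longleftrightarrow> poly Q a = 0"

text \<open>The union of all Stokes curves (including the turning points themselves).
  A point x lies on a Stokes curve iff it can be reached from some turning point a
  by a piecewise C1 path g along which Im of the integral of sqrt Q stays 0, i.e.
  along which (sqrt Q(g t) * g'(t)) is real, i.e. Q(g t) * g'(t)^2 is a nonnegative real.
  This formulation is independent of the choice of branch of sqrt Q.\<close>
definition stokes_set :: "complex poly \<Rightarrow> complex set" where
  "stokes_set Q = {x. \<exists>a g. turning_point Q a \<and> valid_path g \<and>
      pathstart g = a \<and> pathfinish g = x \<and>
      (\<forall>t\<in>{0<..<1}. g differentiable (at t) \<longrightarrow>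
          Im (poly Q (g t) * (vector_derivative g (at t))^2) = 0 \<and>
          Re (poly Q (g t) * (vector_derivative g (at t))^2) \<ge> 0)}"

definition stokes_domain :: "complex poly \<Rightarrow> complex set \<Rightarrow> bool" where
  "stokes_domain Q \<Omega> \<longleftrightarrow> \<Omega> \<in> components (- stokes_set Q)"

end

theory Submission
  imports Defs "HOL-Computational_Algebra.Fundamental_Theorem_Algebra"
begin

text \<open>The map $S$ is a local homeomorphism of $\Omega$ into the upper half-plane, so it suffices to
  construct a global continuous right inverse $G$ of $S$ on the half-plane: then $G \circ S$ and the
  identity are two lifts of $S$ through itself that agree at one point of the connected set $\Omega$,
  hence $G \circ S = \mathrm{id}$. To build $G$, a local inverse is continued along segments. A lift
  of a segment stays bounded, because its speed is $|z_1 - z_0| / |\sqrt Q|$ and $|Q| \ge 1$ near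
  infinity; it also stays away from $\partial\Omega$, because $\operatorname{Im} S$ tends to $0$
  there. So it lives in a compact subset of $\Omega$, on which local inverses exist on discs of
  uniform radius, and the continuation never stops.\<close>

section \<open>Lifts through a locally injective map: uniqueness and gluing\<close>

definition lift_on :: "('a::topological_space \<Rightarrow> 'b::topological_space) \<Rightarrow> 'a set \<Rightarrow> 'b set \<Rightarrow> ('b \<Rightarrow> 'a) \<Rightarrow> bool" where
  "lift_on p X U g \<longleftrightarrow> continuous_on U g \<and> g ` U \<subseteq> X \<and> (\<forall>z\<in>U. p (g z) = z)"

text \<open>Much weaker than a covering map: enough for lifts to be unique, while their existence
  has to come from compactness.\<close>

definition locally_inj_on :: "('a::topological_space \<Rightarrow> 'b) \<Rightarrow> 'a set \<Rightarrow> bool" where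
  "locally_inj_on p X \<longleftrightarrow> (\<forall>x\<in>X. \<exists>U. open U \<and> x \<in> U \<and> inj_on p U)"

lemma lift_on_subset: "lift_on p X U g \<Longrightarrow> V \<subseteq> U \<Longrightarrow> lift_on p X V g"
  unfolding lift_on_def by (meson continuous_on_subset image_mono order_trans subsetD)

text \<open>The coincidence set is clopen in \<open>T\<close>: closed by continuity, open because
  \<open>p\<close> is injective near a common value. Two arbitrary maps with equal composites are
  allowed, not only sections, so that \<open>G \<circ> f\<close> can later be compared with the
  identity.\<close>

lemma locally_inj_lifts_eq:
  fixes f g :: "'a::topological_space \<Rightarrow> 'b::real_normed_vector"
  assumes inj: "locally_inj_on p X" and T: "connected T" "s \<in> T" "t \<in> T"
    and f: "continuous_on T f" "f ` T \<subseteq> X" and g: "continuous_on T g" "g ` T \<subseteq> X"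
    and eq: "\<And>x. x \<in> T \<Longrightarrow> p (f x) = p (g x)" and s: "f s = g s"
  shows "f t = g t"
proof -
  \<comment> \<open>Written with a difference so that \<open>E\<close> is the preimage of a
    constant.\<close>
  define E where "E = {x \<in> T. f x - g x = 0}"
  have "closedin (top_of_set T) E"
    unfolding E_def
    by (intro continuous_closedin_preimage_constant continuous_on_diff f g)
  moreover have "openin (top_of_set T) E"
  proof (subst openin_subopen, intro ballI)
    fix x assume x: "x \<in> E"
    then have "f x \<in> X" "x \<in> T" "f x = g x" using f by (auto simp: E_def)
    then obtain U where U: "open U" "f x \<in> U" "inj_on p U"
      using inj unfolding locally_inj_on_def by blast
    define N where "N = (T \<inter> f -` U) \<inter> (T \<inter> g -` U)"
    have "openin (top_of_set T) N"
      unfolding N_def using U f g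
      by (intro openin_Int continuous_openin_preimage_gen) auto
    moreover have "x \<in> N" using U \<open>x \<in> T\<close> \<open>f x = g x\<close> by (auto simp: N_def)
    moreover have "N \<subseteq> E"
      using U(3) eq by (auto simp: N_def E_def dest: inj_onD)
    ultimately show "\<exists>N. openin (top_of_set T) N \<and> x \<in> N \<and> N \<subseteq> E" by blast
  qed
  ultimately have "E = T"
    using T s connected_clopen[of T] by (auto simp: E_def)
  then show ?thesis using T by (auto simp: E_def)
qed

lemma lift_on_unique:
  fixes g h :: "'b::topological_space \<Rightarrow> 'a::real_normed_vector"
  assumes "locally_inj_on p X" "connected U" "lift_on p X U g" "lift_on p X U h"
    "w \<in> U" "g w = h w" "z \<in> U"
  shows "g z = h z"
  using assms by (intro locally_inj_lifts_eq[of p X U w z g h]) (auto simp: lift_on_def)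

text \<open>Convexity makes every overlap connected, and the common radius \<open>e\<close> forces
  any two overlapping balls to share a point of \<open>C\<close>, where both local lifts equal
  \<open>g\<close>. Hence the local lifts glue.\<close>

lemma lift_on_extend_nbhd:
  fixes p :: "'a::real_normed_vector \<Rightarrow> 'b::real_normed_vector"
  assumes inj: "locally_inj_on p X" and C: "convex C" and g: "lift_on p X C g"
    and loc: "\<And>w. w \<in> C \<Longrightarrow> \<exists>h. lift_on p X (ball w e) h \<and> h w = g w" and "e > 0"
  obtains G where "lift_on p X (\<Union>w\<in>C. ball w e) G" "\<And>w. w \<in> C \<Longrightarrow> G w = g w"
proof -
  obtain h where h: "\<And>w. w \<in> C \<Longrightarrow> lift_on p X (ball w e) (h w) \<and> h w w = g w"
    using loc by metis
  have hg: "h w u = g u" if "w \<in> C" "u \<in> C" "u \<in> ball w e" for w u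
  proof (rule lift_on_unique[OF inj, of "C \<inter> ball w e" _ _ w])
    show "connected (C \<inter> ball w e)" by (intro convex_connected convex_Int C convex_ball)
  qed (use that h g \<open>e > 0\<close> in \<open>auto intro: lift_on_subset\<close>)
  have hh: "h w z = h v z" if "w \<in> C" "v \<in> C" "z \<in> ball w e" "z \<in> ball v e" for w v z
  proof -
    \<comment> \<open>The midpoint ties the two local lifts to the given one.\<close>
    define u where "u = midpoint w v"
    have "dist w v < 2 * e"
      using that dist_triangle[of w v z] by (simp add: dist_commute)
    then have u: "u \<in> ball w e" "u \<in> ball v e"
      by (auto simp: u_def dist_midpoint)
    have "u \<in> C"
      using C that midpoint_in_closed_segment[of w v] closed_segment_subset[of w C v]
      unfolding u_def by blast
    show ?thesis
    proof (rule lift_on_unique[OF inj, of "ball w e \<inter> ball v e" _ _ u])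
      show "connected (ball w e \<inter> ball v e)" by (intro convex_connected convex_Int convex_ball)
      show "h w u = h v u" using hg u \<open>u \<in> C\<close> that by metis
    qed (use that h u in \<open>auto intro: lift_on_subset\<close>)
  qed
  \<comment> \<open>By \<open>hh\<close> the value does not depend on the ball chosen.\<close>
  define G where "G z = h (SOME w. w \<in> C \<and> z \<in> ball w e) z" for z
  have G: "G z = h w z" if "w \<in> C" "z \<in> ball w e" for w z
  proof -
    have "(SOME w. w \<in> C \<and> z \<in> ball w e) \<in> C \<and> z \<in> ball (SOME w. w \<in> C \<and> z \<in> ball w e) e"
      by (rule someI[of _ w]) (use that in auto)
    then show ?thesis unfolding G_def using hh that by blast
  qed
  show ?thesis
  proof
    have "continuous_on (\<Union>w\<in>C. ball w e) G"
    proof (rule continuous_on_open_UN)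
      fix w assume "w \<in> C"
      then show "continuous_on (ball w e) G"
        using h G by (metis continuous_on_cong lift_on_def)
    qed auto
    moreover have "G z \<in> X \<and> p (G z) = z" if "w \<in> C" "z \<in> ball w e" for w z
      using h[OF that(1)] G[OF that] that(2) by (auto simp: lift_on_def)
    ultimately show "lift_on p X (\<Union>w\<in>C. ball w e) G"
      unfolding lift_on_def by blast
    show "G w = g w" if "w \<in> C" for w
      using G[OF that, of w] h[OF that] \<open>e > 0\<close> by simp
  qed
qed

section \<open>Local inverses of holomorphic maps\<close>

lemma holomorphic_locally_inj_on:
  assumes "f holomorphic_on X" "open X" "\<And>x. x \<in> X \<Longrightarrow> deriv f x \<noteq> 0"
  shows "locally_inj_on f X"
  unfolding locally_inj_on_def
  by (metis assms centre_in_ball has_complex_derivative_locally_injective open_ball)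

text \<open>Near each point of \<open>X\<close> one radius serves a whole neighbourhood; finitely
  many such neighbourhoods cover \<open>K\<close>, and the least of their radii serves all of
  \<open>K\<close>.\<close>

lemma holomorphic_lift_uniform_radius:
  assumes hol: "f holomorphic_on X" and X: "open X" and nz: "\<And>x. x \<in> X \<Longrightarrow> deriv f x \<noteq> 0"
    and K: "compact K" "K \<subseteq> X"
  obtains e where "e > 0" "\<And>x. x \<in> K \<Longrightarrow> \<exists>h. lift_on f X (ball (f x) e) h \<and> h (f x) = x"
proof -
  have "\<exists>e N. e > 0 \<and> open N \<and> x \<in> N \<and>
      (\<forall>y\<in>N. \<exists>h. lift_on f X (ball (f y) e) h \<and> h (f y) = y)" if x: "x \<in> X" for x
  proof -
    obtain r where r: "r > 0" "ball x r \<subseteq> X" "inj_on f (ball x r)"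
      using has_complex_derivative_locally_injective[OF hol x X nz[OF x]] by blast
    have holr: "f holomorphic_on ball x r" using hol r holomorphic_on_subset by blast
    obtain h where h: "h holomorphic_on f ` ball x r" "\<And>z. z \<in> ball x r \<Longrightarrow> h (f z) = z"
      using holomorphic_has_inverse[OF holr open_ball r(3)] by metis
    have "open (f ` ball x r)" by (rule open_mapping_thm3[OF holr open_ball r(3)])
    moreover have "f x \<in> f ` ball x r" using r by auto
    ultimately obtain d where d: "d > 0" "ball (f x) d \<subseteq> f ` ball x r"
      using open_contains_ball by metis
    \<comment> \<open>Halving \<open>d\<close> leaves room: for \<open>y \<in> N\<close>, the disc
      of radius \<open>d/2\<close> about \<open>f y\<close> stays inside the disc of radius
      \<open>d\<close> about \<open>f x\<close>.\<close>
    define N where "N = ball x r \<inter> f -` ball (f x) (d/2)"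
    have "open N"
      unfolding N_def
      by (intro continuous_open_preimage holomorphic_on_imp_continuous_on[OF holr]) auto
    moreover have "lift_on f X (ball (f y) (d/2)) h \<and> h (f y) = y" if y: "y \<in> N" for y
    proof -
      have sub: "ball (f y) (d/2) \<subseteq> f ` ball x r"
      proof
        fix z assume "z \<in> ball (f y) (d/2)"
        then have "dist (f x) z < d"
          using y dist_triangle[of "f x" z "f y"] by (simp add: N_def)
        then show "z \<in> f ` ball x r" using d by auto
      qed
      have "lift_on f X (f ` ball x r) h"
        unfolding lift_on_def using h r holomorphic_on_imp_continuous_on[OF h(1)] by auto
      then show ?thesis using sub h y by (auto simp: N_def intro: lift_on_subset)
    qed
    moreover have "x \<in> N" using r d by (auto simp: N_def)
    ultimately show ?thesis using d(1) half_gt_zero by blast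
  qed
  then obtain \<epsilon> N where N: "\<And>x. x \<in> X \<Longrightarrow> \<epsilon> x > 0 \<and> open (N x) \<and> x \<in> N x \<and>
      (\<forall>y\<in>N x. \<exists>h. lift_on f X (ball (f y) (\<epsilon> x)) h \<and> h (f y) = y)"
    by metis
  obtain D where D: "D \<subseteq> K" "finite D" "K \<subseteq> (\<Union>x\<in>D. N x)"
  proof (rule compactE_image[OF K(1), of K N])
    show "K \<subseteq> (\<Union>x\<in>K. N x)" using N K by blast
  qed (use N K in auto)
  \<comment> \<open>The inserted 1 keeps the minimum meaningful when \<open>D\<close> is
    empty.\<close>
  define e where "e = Min (insert 1 (\<epsilon> ` D))"
  have "e > 0" using D N K by (auto simp: e_def)
  moreover have "\<exists>h. lift_on f X (ball (f y) e) h \<and> h (f y) = y" if "y \<in> K" for y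
  proof -
    obtain x where x: "x \<in> D" "y \<in> N x" using D \<open>y \<in> K\<close> by blast
    then have "e \<le> \<epsilon> x" using D by (auto simp: e_def)
    then have "ball (f y) e \<subseteq> ball (f y) (\<epsilon> x)" by auto
    then show ?thesis using N[of x] x D K by (meson lift_on_subset subsetD)
  qed
  ultimately show ?thesis using that by blast
qed

text \<open>The inverse function rule turns a continuous lift into a holomorphic one. It gives the
  speed of a lifted segment and, at the end, the holomorphy of the global inverse.\<close>

lemma lift_on_has_field_derivative:
  fixes f :: "complex \<Rightarrow> complex"
  assumes "f holomorphic_on X" "open X" "\<And>x. x \<in> X \<Longrightarrow> deriv f x \<noteq> 0"
    and "lift_on f X V g" "open V" "z \<in> V"
  shows "(g has_field_derivative inverse (deriv f (g z))) (at z)"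
proof (rule has_field_derivative_inverse_basic)
  have gz: "g z \<in> X" using assms by (auto simp: lift_on_def)
  then show "(f has_field_derivative deriv f (g z)) (at (g z))"
    using assms holomorphic_derivI by blast
  show "deriv f (g z) \<noteq> 0" using gz assms by blast
  show "isCont g z" using assms by (auto simp: lift_on_def continuous_on_eq_continuous_at)
qed (use assms in \<open>auto simp: lift_on_def\<close>)

section \<open>Continuation along segments\<close>

text \<open>Outside the disc of radius \<open>M\<close> the lift of the segment has speed at most
  \<open>norm (z - w)\<close>, so in unit time after its last visit to the disc it moves no further
  than that.\<close>

lemma lift_on_segment_norm_bound:
  fixes f :: "complex \<Rightarrow> complex"
  assumes hol: "f holomorphic_on X" and X: "open X" and nz: "\<And>x. x \<in> X \<Longrightarrow> deriv f x \<noteq> 0"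
    and g: "lift_on f X V g" "open V" "closed_segment w z \<subseteq> V"
    and big: "\<And>x. x \<in> X \<Longrightarrow> M < norm x \<Longrightarrow> 1 \<le> norm (deriv f x)" and w: "norm (g w) \<le> M"
  shows "norm (g z) \<le> M + norm (z - w)"
proof (cases "norm (g z) \<le> M")
  case True
  then show ?thesis using norm_ge_zero[of "z - w"] by linarith
next
  case False
  define q where "q t = g (linepath w z t)" for t
  have seg: "linepath w z t \<in> V" if "t \<in> {0..1}" for t
    using g(3) linepath_in_path[OF that] by blast
  have contq: "continuous_on {0..1} q"
    unfolding q_def
  proof (rule continuous_on_compose2[of V g])
    show "continuous_on V g" using g(1) by (simp add: lift_on_def)
  qed (use seg in auto)
  have q01: "q 0 = g w" "q 1 = g z" by (simp_all add: q_def linepath_def)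
  define A where "A = {0..1} \<inter> (\<lambda>t. norm (q t)) -` {..M}"
  have "closed A"
    unfolding A_def
    by (intro continuous_closed_preimage continuous_on_norm contq) auto
  moreover have "0 \<in> A" using w q01 by (auto simp: A_def)
  moreover have "bdd_above A" by (auto simp: A_def intro: bdd_aboveI[of _ 1])
  ultimately have sA: "Sup A \<in> A" using closed_contains_Sup by blast
  \<comment> \<open>The last time at which the lift is in the disc of radius \<open>M\<close>.\<close>
  define s where "s = Sup A"
  have s: "s \<in> {0..1}" "norm (q s) \<le> M" using sA by (auto simp: A_def s_def)
  have after: "M < norm (q t)" if "s < t" "t \<le> 1" for t
    using that cSup_upper[of t A] \<open>bdd_above A\<close> s by (fastforce simp: A_def s_def)
  have "s < 1" using s False q01 by (cases "s = 1") auto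
  have "norm (q 1 - q s) \<le> norm (z - w) * 1 - norm (z - w) * s"
  \<comment> \<open>Mean value inequality on \<open>{s..1}\<close> with comparison function
    \<open>norm (z - w) * t\<close>.\<close>
  proof (rule differentiable_bound_general[OF \<open>s < 1\<close>])
    show "continuous_on {s..1} q" using contq s by (auto intro: continuous_on_subset)
    show "continuous_on {s..1} (\<lambda>t. norm (z - w) * t)" by (intro continuous_intros)
    fix t assume t: "s < t" "t < 1"
    show "((\<lambda>t. norm (z - w) * t) has_vector_derivative norm (z - w)) (at t)"
      by (auto intro!: derivative_eq_intros simp: has_real_derivative_iff_has_vector_derivative[symmetric])
    have tV: "linepath w z t \<in> V" using seg s t by auto
    have "((g \<circ> linepath w z) has_vector_derivative (z - w) * inverse (deriv f (q t))) (at t)"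
      unfolding q_def
      by (intro field_vector_diff_chain_at has_vector_derivative_linepath_within
          lift_on_has_field_derivative[OF hol X nz g(1,2) tV])
    then show "(q has_vector_derivative (z - w) * inverse (deriv f (q t))) (at t)"
      by (simp add: q_def[abs_def] o_def)
    have "q t \<in> X" using g(1) tV by (auto simp: lift_on_def q_def)
    then have "1 \<le> norm (deriv f (q t))" using big after t by auto
    then have "norm (inverse (deriv f (q t))) \<le> 1"
      by (simp add: norm_inverse inverse_le_1_iff)
    then show "norm ((z - w) * inverse (deriv f (q t))) \<le> norm (z - w)"
      unfolding norm_mult using mult_left_le norm_ge_zero by blast
  qed
  also have "\<dots> \<le> norm (z - w)" using s by simp
  finally have "norm (q 1 - q s) \<le> norm (z - w)" .
  then have "norm (q 1) \<le> M + norm (z - w)"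
    using s(2) norm_triangle_sub[of "q 1" "q s"] by linarith
  then show ?thesis by (simp add: q01)
qed

text \<open>The compact set \<open>K\<close> that confines every partial lift is fixed in advance,
  so one radius \<open>e\<close> serves all steps and finitely many of them reach
  \<open>z\<close>.\<close>

lemma lift_along_segment:
  fixes f :: "complex \<Rightarrow> complex"
  assumes hol: "f holomorphic_on X" and X: "open X" and nz: "\<And>x. x \<in> X \<Longrightarrow> deriv f x \<noteq> 0"
    and Y: "convex Y" "f ` X \<subseteq> Y"
    and proper: "\<And>B L. compact L \<Longrightarrow> L \<subseteq> Y \<Longrightarrow> compact {x \<in> X. norm x \<le> B \<and> f x \<in> L}"
    and big: "\<And>x. x \<in> X \<Longrightarrow> M < norm x \<Longrightarrow> 1 \<le> norm (deriv f x)"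
    and x0: "x0 \<in> X" and z: "z \<in> Y"
  obtains V g where "open V" "convex V" "closed_segment (f x0) z \<subseteq> V" "lift_on f X V g" "g (f x0) = x0"
proof -
  define z0 where "z0 = f x0"
  \<comment> \<open>Enlarged so that the starting point \<open>x0\<close> lies in the disc, as the
    norm bound requires; \<open>big\<close> persists for larger radii.\<close>
  define M' where "M' = max M (norm x0)"
  define L where "L = closed_segment z0 z"
  define B where "B = M' + norm (z - z0)"
  define K where "K = {x \<in> X. norm x \<le> B \<and> f x \<in> L}"
  have inj: "locally_inj_on f X" by (rule holomorphic_locally_inj_on[OF hol X nz])
  have "L \<subseteq> Y" unfolding L_def z0_def using Y x0 z by (intro closed_segment_subset) auto
  then have "compact K" unfolding K_def using proper[of L] by (simp add: L_def)
  moreover have "K \<subseteq> X" by (auto simp: K_def)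
  ultimately obtain e where e: "e > 0"
      and loc: "\<And>x. x \<in> K \<Longrightarrow> \<exists>h. lift_on f X (ball (f x) e) h \<and> h (f x) = x"
    using holomorphic_lift_uniform_radius[OF hol X nz] by blast
  \<comment> \<open>One continuation step: a lift over a convex set with values in \<open>K\<close>
    extends to the \<open>e\<close>-neighbourhood of that set, which contains the next
    point.\<close>
  have extend: "\<exists>V G. open V \<and> convex V \<and> closed_segment z0 v \<subseteq> V \<and> lift_on f X V G \<and> G z0 = x0"
    if C: "convex C" "z0 \<in> C" "u \<in> C" and v: "dist u v < e"
      and g: "lift_on f X C g" "g z0 = x0" and K: "g ` C \<subseteq> K" for C g u v
  proof -
    define V where "V = (\<Union>w\<in>C. ball w e)"
    have loc': "\<exists>h. lift_on f X (ball w e) h \<and> h w = g w" if "w \<in> C" for w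
      using loc[of "g w"] g(1) K that by (auto simp: lift_on_def)
    obtain G where G: "lift_on f X V G" "\<And>w. w \<in> C \<Longrightarrow> G w = g w"
      unfolding V_def by (rule lift_on_extend_nbhd[OF inj C(1) g(1) loc' e]) auto
    \<comment> \<open>As a Minkowski sum of \<open>C\<close> and a ball, \<open>V\<close> is
      convex.\<close>
    have "V = (\<Union>x\<in>C. \<Union>y\<in>ball 0 e. {x + y})"
    proof (intro equalityI subsetI)
      fix y assume "y \<in> V"
      then obtain w where "w \<in> C" "dist w y < e" by (auto simp: V_def)
      moreover have "y = w + (y - w)" by simp
      ultimately have "w \<in> C" "y - w \<in> ball 0 e" "y = w + (y - w)"
        by (auto simp: dist_norm norm_minus_commute)
      then show "y \<in> (\<Union>x\<in>C. \<Union>y\<in>ball 0 e. {x + y})" by blast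
    next
      fix y assume "y \<in> (\<Union>x\<in>C. \<Union>y\<in>ball 0 e. {x + y})"
      then obtain w d where "w \<in> C" "d \<in> ball 0 e" "y = w + d" by blast
      then have "w \<in> C" "y \<in> ball w e" by (auto simp: dist_norm)
      then show "y \<in> V" unfolding V_def by blast
    qed
    then have "convex V" using convex_sums[OF C(1) convex_ball] by simp
    moreover have "z0 \<in> V" "v \<in> V" using C v e by (force simp: V_def)+
    ultimately have "closed_segment z0 v \<subseteq> V" by (simp add: closed_segment_subset)
    moreover have "open V" by (auto simp: V_def)
    ultimately show ?thesis using \<open>convex V\<close> G C g by metis
  qed
  obtain n :: nat where n: "n > 0" "norm (z - z0) / e < n"
    by (metis reals_Archimedean2 gr0I of_nat_0 divide_nonneg_pos e norm_ge_zero not_le)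
  define c where "c k = linepath z0 z (real k / real n)" for k
  have cL: "c k \<in> L" if "k \<le> n" for k
    unfolding c_def L_def by (rule linepath_in_path) (use that n in auto)
  have cdist: "dist (c k) (c (Suc k)) < e" for k
  proof -
    have "c (Suc k) - c k = (z - z0) / of_nat n"
      unfolding c_def linepath_def scaleR_conv_of_real using n
      by (simp add: field_simps)
    then have "dist (c k) (c (Suc k)) = norm (z - z0) / n"
      by (metis dist_commute dist_norm norm_divide norm_of_nat)
    also have "\<dots> < e" using n e by (simp add: field_simps)
    finally show ?thesis .
  qed
  have "\<exists>V g. open V \<and> convex V \<and> closed_segment z0 (c k) \<subseteq> V \<and> lift_on f X V g \<and> g z0 = x0"
    if "k \<le> n" for k
    using that
  proof (induction k)
    case 0
    have "norm x0 \<le> B" unfolding B_def M'_def by (intro add_increasing2) auto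
    then have "x0 \<in> K" using x0 by (simp add: K_def L_def z0_def)
    \<comment> \<open>The constant lift over the singleton \<open>{z0}\<close> starts the
      continuation.\<close>
    then show ?case
      using x0 e by (intro extend[of "{z0}" z0 "c 0" "\<lambda>_. x0"])
        (auto simp: c_def linepath_def lift_on_def z0_def)
  next
    case (Suc k)
    then obtain V g where g: "open V" "closed_segment z0 (c k) \<subseteq> V" "lift_on f X V g" "g z0 = x0"
      by auto
    \<comment> \<open>The lift is cut back to the closed segment before being extended: off the
      segment its values need not lie in \<open>K\<close>.\<close>
    have "g u \<in> K" if u: "u \<in> closed_segment z0 (c k)" for u
    proof -
      have uL: "u \<in> L"
        using u cL[of k] Suc.prems closed_segment_subset[of z0 L "c k"] by (auto simp: L_def)
      have "closed_segment z0 u \<subseteq> V"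
        using u g(2) by (meson closed_segment_subset convex_closed_segment ends_in_segment(1) order_trans)
      then have "norm (g u) \<le> M' + norm (u - z0)"
        using big g(4) by (intro lift_on_segment_norm_bound[OF hol X nz g(3,1)]) (auto simp: M'_def)
      also have "norm (u - z0) \<le> norm (z - z0)"
        using segment_bound(1)[of u z0 z] uL by (simp add: L_def norm_minus_commute)
      finally have "norm (g u) \<le> B" by (simp add: B_def)
      moreover have "g u \<in> X" "f (g u) = u" using g u by (auto simp: lift_on_def)
      ultimately show ?thesis using uL by (simp add: K_def)
    qed
    then show ?case
      using g(4) cdist[of k] lift_on_subset[OF g(3,2)]
      by (intro extend[of "closed_segment z0 (c k)" "c k" "c (Suc k)" g]) auto
  qed
  from this[of n] show ?thesis
    using that n by (auto simp: c_def linepath_def z0_def)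
qed

section \<open>The global inverse on a convex target\<close>

text \<open>Lifts along the segments from \<open>f x0\<close> have convex domains that all contain
  \<open>f x0\<close>, so any two agree on their overlap and no monodromy arises.
  \<open>proper\<close> controls only bounded parts of preimages; \<open>big\<close> prevents escape
  to infinity.\<close>

lemma proper_local_biholomorphism_inverse:
  fixes f :: "complex \<Rightarrow> complex"
  assumes hol: "f holomorphic_on X" and X: "open X" "connected X" "X \<noteq> {}"
    and nz: "\<And>x. x \<in> X \<Longrightarrow> deriv f x \<noteq> 0"
    and Y: "convex Y" "f ` X \<subseteq> Y"
    and proper: "\<And>B L. compact L \<Longrightarrow> L \<subseteq> Y \<Longrightarrow> compact {x \<in> X. norm x \<le> B \<and> f x \<in> L}"
    and big: "\<And>x. x \<in> X \<Longrightarrow> M < norm x \<Longrightarrow> 1 \<le> norm (deriv f x)"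
  obtains G where "lift_on f X Y G" "\<And>x. x \<in> X \<Longrightarrow> G (f x) = x"
proof -
  obtain x0 where x0: "x0 \<in> X" using X by auto
  have inj: "locally_inj_on f X" by (rule holomorphic_locally_inj_on[OF hol X(1) nz])
  have "\<exists>V g. open V \<and> convex V \<and> f x0 \<in> V \<and> z \<in> V \<and> lift_on f X V g \<and> g (f x0) = x0"
    if "z \<in> Y" for z
  proof -
    obtain V g where "open V" "convex V" "closed_segment (f x0) z \<subseteq> V" "lift_on f X V g" "g (f x0) = x0"
      using lift_along_segment[OF hol X(1) nz Y proper big x0 \<open>z \<in> Y\<close>] by blast
    then show ?thesis using ends_in_segment[of "f x0" z] by blast
  qed
  then obtain V g where Vg: "\<And>z. z \<in> Y \<Longrightarrow> open (V z) \<and> convex (V z) \<and> f x0 \<in> V z \<and> z \<in> V z \<and>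
      lift_on f X (V z) (g z) \<and> g z (f x0) = x0"
    by metis
  \<comment> \<open>Each point of \<open>V z\<close> is the value of \<open>f\<close> at its lift,
    hence lies in \<open>Y\<close>.\<close>
  have VY: "V z \<subseteq> Y" if "z \<in> Y" for z
    using Vg[OF that] Y(2) by (force simp: lift_on_def)
  define G where "G z = g z z" for z
  have G: "G y = g z y" if "z \<in> Y" "y \<in> V z" for z y
  proof -
    have y: "y \<in> Y" using VY that by blast
    show ?thesis unfolding G_def
    proof (rule lift_on_unique[OF inj, of "V y \<inter> V z" "g y" "g z" "f x0"])
      show "connected (V y \<inter> V z)" using Vg that y by (intro convex_connected convex_Int) auto
    qed (use Vg[OF y] Vg[OF that(1)] that in \<open>auto intro: lift_on_subset\<close>)
  qed
  have "Y = (\<Union>z\<in>Y. V z)" using VY Vg by blast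
  moreover have "continuous_on (\<Union>z\<in>Y. V z) G"
  proof (rule continuous_on_open_UN)
    fix z assume "z \<in> Y"
    then show "continuous_on (V z) G"
      using Vg G by (metis continuous_on_cong lift_on_def)
  qed (use Vg in auto)
  ultimately have "continuous_on Y G" by simp
  moreover have "G z \<in> X \<and> f (G z) = z" if "z \<in> Y" for z
    using Vg[OF that] by (auto simp: G_def lift_on_def)
  ultimately have lift: "lift_on f X Y G" by (auto simp: lift_on_def)
  have contf: "continuous_on X f" by (rule holomorphic_on_imp_continuous_on[OF hol])
  have "G (f x) = x" if x: "x \<in> X" for x
  proof (rule locally_inj_lifts_eq[OF inj X(2) x0 x, of "\<lambda>x. G (f x)" "\<lambda>x. x"])
    show "continuous_on X (\<lambda>x. G (f x))"
    proof (rule continuous_on_compose2[of Y G])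
      show "continuous_on Y G" using lift by (simp add: lift_on_def)
    qed (use contf Y(2) in auto)
    show "G (f x0) = x0" using Vg x0 Y(2) by (auto simp: G_def)
  qed (use lift Y(2) in \<open>auto simp: lift_on_def\<close>)
  with lift that show ?thesis by blast
qed

section \<open>Growth of \<open>Q\<close>, turning points and boundary behaviour\<close>

lemma poly_eventually_ge_1:
  fixes Q :: "complex poly"
  assumes "degree Q \<ge> 1"
  obtains M where "\<And>x. M < norm x \<Longrightarrow> 1 \<le> norm (poly Q x)"
proof -
  obtain c p where Q: "Q = pCons c p" by (cases Q)
  with assms have "p \<noteq> 0" by (auto split: if_splits)
  then obtain r where "\<forall>z. r \<le> norm z \<longrightarrow> 1 \<le> norm (poly Q z)"
    using poly_infinity Q by blast
  then show ?thesis using that[of r] by auto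
qed

text \<open>The constant path has zero derivative, so the sign conditions hold along it.
  Consequently no zero of \<open>Q\<close> lies in a Stokes domain.\<close>

lemma turning_point_in_stokes_set: "turning_point Q a \<Longrightarrow> a \<in> stokes_set Q"
  unfolding stokes_set_def
  by (auto intro!: exI[of _ "linepath a a"])

text \<open>At a frontier point inside \<open>X\<close>, \<open>Im (S x)\<close> would tend both to
  0 and to a positive value. This yields openness of a Stokes domain without showing that the Stokes
  set is closed.\<close>

lemma open_if_Im_vanishes_at_frontier:
  fixes X :: "complex set" and S :: "complex \<Rightarrow> complex"
  assumes "connected X" "a \<in> frontier X" "a \<notin> X" "continuous_on X S"
    and pos: "\<And>x. x \<in> X \<Longrightarrow> Im (S x) > 0"
    and lim: "\<And>y. y \<in> frontier X \<Longrightarrow> ((\<lambda>x. Im (S x)) \<longlongrightarrow> 0) (at y within X)"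
  shows "open X"
proof -
  have "x \<notin> frontier X" if x: "x \<in> X" for x
  proof
    assume "x \<in> frontier X"
    then have l0: "((\<lambda>x. Im (S x)) \<longlongrightarrow> 0) (at x within X)" by (rule lim)
    have l1: "((\<lambda>x. Im (S x)) \<longlongrightarrow> Im (S x)) (at x within X)"
      using \<open>continuous_on X S\<close> x by (intro tendsto_Im) (auto simp: continuous_on_def)
    \<comment> \<open>A singleton is its own closure, so \<open>a\<close> would belong to it.
      Excluding this makes \<open>x\<close> a limit point, and limits there are unique.\<close>
    have "X \<noteq> {x}"
      using assms(2,3) by (auto simp: frontier_def)
    then have "x islimpt X"
      using connected_imp_perfect[OF \<open>connected X\<close>] x by blast
    then have "at x within X \<noteq> bot" by (simp add: trivial_limit_within)
    then show False using tendsto_unique[OF _ l0 l1] pos[OF x] by simp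
  qed
  then have "X \<subseteq> interior X" using closure_subset by (auto simp: frontier_def)
  then show ?thesis by (metis interior_subset interior_eq subset_antisym)
qed

text \<open>A sequence in the set cannot converge to the frontier: \<open>Im (S x)\<close> would
  tend to 0, whereas a subsequence of the images converges in \<open>L\<close>, where imaginary
  parts are positive.\<close>

lemma compact_preimage_if_Im_vanishes_at_frontier:
  fixes X :: "complex set" and S :: "complex \<Rightarrow> complex"
  assumes X: "open X" and cont: "continuous_on X S"
    and lim: "\<And>y. y \<in> frontier X \<Longrightarrow> ((\<lambda>x. Im (S x)) \<longlongrightarrow> 0) (at y within X)"
    and L: "compact L" "L \<subseteq> {z. Im z > 0}"
  shows "compact {x \<in> X. norm x \<le> B \<and> S x \<in> L}"
  unfolding compact_eq_bounded_closed
proof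
  show "bounded {x \<in> X. norm x \<le> B \<and> S x \<in> L}" by (auto simp: bounded_iff)
  show "closed {x \<in> X. norm x \<le> B \<and> S x \<in> L}"
    unfolding closed_sequential_limits
  proof (intro allI impI, elim conjE)
    fix x l assume x: "\<forall>n. x n \<in> {x \<in> X. norm x \<le> B \<and> S x \<in> L}" and l: "x \<longlonglongrightarrow> l"
    have "norm l \<le> B"
      using x l by (intro LIMSEQ_le_const2[OF tendsto_norm[OF l]]) auto
    obtain w r where w: "w \<in> L" "strict_mono r" "(\<lambda>n. S (x (r n))) \<longlonglongrightarrow> w"
      using L(1)[unfolded compact_def, rule_format, of "\<lambda>n. S (x n)"] x by (auto simp: o_def)
    have xr: "(\<lambda>n. x (r n)) \<longlonglongrightarrow> l" using LIMSEQ_subseq_LIMSEQ[OF l w(2)] by (simp add: o_def)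
    have "l \<in> X"
    proof (rule ccontr)
      assume "l \<notin> X"
      have "l \<in> closure X" using x l closure_sequential by blast
      then have "l \<in> frontier X" using X \<open>l \<notin> X\<close> by (simp add: frontier_def interior_open)
      then have "((\<lambda>x. Im (S x)) \<longlongrightarrow> 0) (at l within X)" by (rule lim)
      moreover have "filterlim (\<lambda>n. x (r n)) (at l within X) sequentially"
        unfolding filterlim_at using x xr \<open>l \<notin> X\<close> by (auto intro!: always_eventually)
      ultimately have "(\<lambda>n. Im (S (x (r n)))) \<longlonglongrightarrow> 0" by (rule filterlim_compose)
      moreover have "(\<lambda>n. Im (S (x (r n)))) \<longlonglongrightarrow> Im w" by (rule tendsto_Im[OF w(3)])
      ultimately have "Im w = 0" using LIMSEQ_unique by blast
      then show False using w(1) L(2) by auto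
    qed
    then have "(\<lambda>n. S (x (r n))) \<longlonglongrightarrow> S l"
      using cont x xr by (intro continuous_on_tendsto_compose[of X S]) auto
    then have "S l \<in> L" using w LIMSEQ_unique by blast
    then show "l \<in> {x \<in> X. norm x \<le> B \<and> S x \<in> L}"
      using \<open>l \<in> X\<close> \<open>norm l \<le> B\<close> by simp
  qed
qed

text \<open>Since \<open>S\<close> is given only on \<open>\<Omega>\<close>, its boundary values,
  and with them type (1), are expressed by limits within \<open>\<Omega>\<close>; the equation for
  the square of \<open>deriv S\<close> says that \<open>deriv S\<close> is a branch of the root of
  \<open>Q\<close>.\<close>

theorem theorem5p3:
  fixes Q :: "complex poly" and \<Omega> :: "complex set" and a :: complex and S :: "complex \<Rightarrow> complex"
  assumes "degree Q \<ge> 1"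
    and "stokes_domain Q \<Omega>"
    and "turning_point Q a" and "a \<in> frontier \<Omega>"
    and "S holomorphic_on \<Omega>"
    and "\<forall>x\<in>\<Omega>. (deriv S x)^2 = poly Q x"
    and "(S \<longlongrightarrow> 0) (at a within \<Omega>)"
    and "\<forall>x\<in>\<Omega>. Im (S x) > 0"
    and "connected (frontier \<Omega>)"
    and "\<forall>y\<in>frontier \<Omega>. ((\<lambda>x. Im (S x)) \<longlongrightarrow> 0) (at y within \<Omega>)"
  shows "bij_betw S \<Omega> {z. Im z > 0} \<and> (\<forall>x\<in>\<Omega>. deriv S x \<noteq> 0) \<and>
         (\<exists>g. g holomorphic_on {z. Im z > 0} \<and> (\<forall>x\<in>\<Omega>. g (S x) = x) \<and>
              (\<forall>z. Im z > 0 \<longrightarrow> S (g z) = z))"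
proof -
  have comp: "\<Omega> \<in> components (- stokes_set Q)"
    using assms(2) by (simp add: stokes_domain_def)
  have conn: "connected \<Omega>" "\<Omega> \<noteq> {}"
    using comp in_components_connected in_components_nonempty by blast+
  have disj: "\<Omega> \<inter> stokes_set Q = {}"
    using in_components_subset[OF comp] by blast
  have cont: "continuous_on \<Omega> S" by (rule holomorphic_on_imp_continuous_on[OF assms(5)])
  have "a \<notin> \<Omega>" using turning_point_in_stokes_set[OF assms(3)] disj by blast
  then have op: "open \<Omega>"
    using open_if_Im_vanishes_at_frontier[OF conn(1) assms(4) _ cont] assms(8,10) by blast
  have nz: "deriv S x \<noteq> 0" if "x \<in> \<Omega>" for x
  proof
    assume "deriv S x = 0"
    then have "turning_point Q x" using assms(6) that by (force simp: turning_point_def)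
    then show False using turning_point_in_stokes_set disj that by blast
  qed
  obtain M where M: "\<And>x. M < norm x \<Longrightarrow> 1 \<le> norm (poly Q x)"
    using poly_eventually_ge_1[OF assms(1)] by blast
  have big: "1 \<le> norm (deriv S x)" if "x \<in> \<Omega>" "M < norm x" for x
  proof -
    have "1 \<le> norm (deriv S x) ^ 2"
      using M[OF that(2)] assms(6) that(1) by (metis norm_power)
    then show ?thesis using power2_le_imp_le[of 1 "norm (deriv S x)"] by simp
  qed
  obtain G where G: "lift_on S \<Omega> {z. Im z > 0} G" "\<And>x. x \<in> \<Omega> \<Longrightarrow> G (S x) = x"
  \<comment> \<open>The target is the upper half-plane, which is convex; the compactness condition
    comes from the vanishing of \<open>Im (S x)\<close> at the frontier.\<close>
  proof (rule proper_local_biholomorphism_inverse[OF assms(5) op conn nz, of "{z. Im z > 0}" M])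
    show "convex {z. Im z > 0}" by (rule convex_halfspace_Im_gt)
    show "compact {x \<in> \<Omega>. norm x \<le> B \<and> S x \<in> L}" if "compact L" "L \<subseteq> {z. Im z > 0}" for B L
      using compact_preimage_if_Im_vanishes_at_frontier[OF op cont _ that] assms(10) by blast
  qed (use assms(8) big in auto)
  have SG: "S (G z) = z" "G z \<in> \<Omega>" if "Im z > 0" for z
    using G(1) that by (auto simp: lift_on_def)
  have "bij_betw S \<Omega> {z. Im z > 0}"
    by (rule bij_betw_byWitness[of _ G]) (use G SG assms(8) in auto)
  moreover have "G holomorphic_on {z. Im z > 0}"
    unfolding holomorphic_on_def field_differentiable_def
    using lift_on_has_field_derivative[OF assms(5) op nz G(1) open_halfspace_Im_gt]
    by (meson has_field_derivative_at_within)
  ultimately show ?thesis using nz G(2) SG by blast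
qed

end
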